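(* Let $\Sigma$ be a finite alphabet, let $k\in\mathbb{N}$ and let $w,\tilde w\in\Sigma^*$ with $m\coloneqq\iota(w)=\iota(\tilde w)<k$. Let $w=\alpha_0\beta_1\alpha_1\cdots\beta_m\alpha_m$ and $\tilde w=\tilde\alpha_0\tilde\beta_1\tilde\alpha_1\cdots\tilde\beta_m\tilde\alpha_m$ be their $\alpha$-$\beta$-factorizations. Then $w\sim_k\tilde w$ if and only if $\alpha_{i-1}\beta_i\alpha_i\sim_{k-m+1}\tilde\alpha_{i-1}\tilde\beta_i\tilde\alpha_i$ for all $i\in\{1,\dots,m\}$.
   Context: A word $u$ is a scattered factor of $w$ (written $u\preceq w$) if $w=v_0u[1]v_1\cdots v_{n-1}u[n]v_n$ for some words $v_0,\dots,v_n$, where $n=|u|$. For $k\in\mathbb{N}_0$, $u\sim_k v$ (Simon's congruence) iff $u$ and $v$ have exactly the same scattered factors of length at most $k$. $\iota(w)$ (universality index w.r.t. $\Sigma$) is the largest $\ell$ such that every word of $\Sigma^\ell$ is a scattered factor of $w$. The arch factorization of $w$ is the unique factorization $w=\mathrm{ar}_1(w)\cdots\mathrm{ar}_\ell(w)\mathrm{re}(w)$ where each arch $\mathrm{ar}_i(w)$ contains every letter of $\Sigma$ and its last letter occurs exactly once in it, and the rest $\mathrm{re}(w)$ does not contain every letter of $\Sigma$; here $\ell=\iota(w)$. With $w^R$ the reversal of $w$, define reverse arches $\mathrm{ra}_i(w)\coloneqq(\mathrm{ar}_{\iota(w)-i+1}(w^R))^R$ and reverse rest $\mathrm{er}(w)\coloneqq(\mathrm{re}(w^R))^R$.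 The $\alpha$-$\beta$-factorization of $w$ is $w=\alpha_0\beta_1\alpha_1\cdots\alpha_{\iota(w)-1}\beta_{\iota(w)}\alpha_{\iota(w)}$ with $\mathrm{ar}_i(w)=\alpha_{i-1}\beta_i$ and $\mathrm{ra}_i(w)=\beta_i\alpha_i$ for all $i\in\{1,\dots,\iota(w)\}$, $\alpha_0=\mathrm{er}(w)$ and $\alpha_{\iota(w)}=\mathrm{re}(w)$.
   Formalization: The formal theorem additionally assumes m ≥ 1; for m = 0 the right-hand side is vacuous and the claim fails, e.g. Σ = {a,b}, w = a, w̃ = b, k = 1. *)

theory Defs
  imports Main "HOL-Library.Sublist"
begin

text \<open>Words are lists, the alphabet is a set \<open>S\<close>, a word over \<open>S\<close> is an element of \<open>lists S\<close>, and
  \<open>u\<close> is a scattered factor of \<open>w\<close> iff \<open>subseq u w\<close>.\<close>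

definition simon_cong :: "nat \<Rightarrow> 'a list \<Rightarrow> 'a list \<Rightarrow> bool" where
  "simon_cong k u v \<longleftrightarrow> (\<forall>x. length x \<le> k \<longrightarrow> (subseq x u \<longleftrightarrow> subseq x v))"

definition univ_index :: "'a set \<Rightarrow> 'a list \<Rightarrow> nat" where
  "univ_index S w = (GREATEST l. \<forall>u \<in> lists S. length u = l \<longrightarrow> subseq u w)"

definition is_arch :: "'a set \<Rightarrow> 'a list \<Rightarrow> bool" where
  "is_arch S a \<longleftrightarrow> S \<subseteq> set a \<and> count_list a (last a) = 1"

definition is_arch_factorization :: "'a set \<Rightarrow> 'a list \<Rightarrow> 'a list list \<Rightarrow> 'a list \<Rightarrow> bool" where
  "is_arch_factorization S w as r \<longleftrightarrow>
     w = concat as @ r \<and> (\<forall>a \<in> set as. is_arch S a) \<and> \<not> S \<subseteq> set r"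

text \<open>Existence and uniqueness of the arch factorization of a word over a nonempty alphabet, and
  the fact that it has \<open>univ_index S w\<close> many arches, are proved at the end of this theory.\<close>

definition arch_factorization :: "'a set \<Rightarrow> 'a list \<Rightarrow> 'a list list \<times> 'a list" where
  "arch_factorization S w = (THE (as, r). is_arch_factorization S w as r)"

text \<open>Arches are numbered from 1.\<close>

definition ar :: "'a set \<Rightarrow> 'a list \<Rightarrow> nat \<Rightarrow> 'a list" where
  "ar S w i = fst (arch_factorization S w) ! (i - 1)"

definition re :: "'a set \<Rightarrow> 'a list \<Rightarrow> 'a list" where
  "re S w = snd (arch_factorization S w)"

definition ra :: "'a set \<Rightarrow> 'a list \<Rightarrow> nat \<Rightarrow> 'a list" where
  "ra S w i = rev (ar S (rev w) (univ_index S w - i + 1))"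

definition er :: "'a set \<Rightarrow> 'a list \<Rightarrow> 'a list" where
  "er S w = rev (re S (rev w))"

text \<open>Only the values of \<open>\<alpha>\<close> on \<open>{0..univ_index S w}\<close> and of \<open>\<beta>\<close> on \<open>{1..univ_index S w}\<close> matter.\<close>

definition is_alpha_beta_factorization ::
    "'a set \<Rightarrow> 'a list \<Rightarrow> (nat \<Rightarrow> 'a list) \<Rightarrow> (nat \<Rightarrow> 'a list) \<Rightarrow> bool" where
  "is_alpha_beta_factorization S w \<alpha> \<beta> \<longleftrightarrow>
     w = \<alpha> 0 @ concat (map (\<lambda>i. \<beta> i @ \<alpha> i) [1..<Suc (univ_index S w)]) \<and>
     (\<forall>i \<in> {1..univ_index S w}. ar S w i = \<alpha> (i - 1) @ \<beta> i \<and> ra S w i = \<beta> i @ \<alpha> i) \<and>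
     \<alpha> 0 = er S w \<and> \<alpha> (univ_index S w) = re S w"

lemma is_arch_iff:
  "is_arch S a \<longleftrightarrow> S \<subseteq> set a \<and> a \<noteq> [] \<and> last a \<notin> set (butlast a)"
  by (cases a rule: rev_cases) (auto simp: is_arch_def count_list_0_iff)

lemma arch_factorization_exists:
  assumes "S \<noteq> {}"
  shows "\<exists>as r. is_arch_factorization S w as r"
proof (induction w rule: length_induct)
  case (1 w)
  show ?case
  proof (cases "S \<subseteq> set w")
    case False
    then have "is_arch_factorization S w [] w" by (simp add: is_arch_factorization_def)
    then show ?thesis by blast
  next
    case True
    define n where "n = (LEAST n. S \<subseteq> set (take n w))"
    have ex: "S \<subseteq> set (take (length w) w)" using True by simp
    have n: "S \<subseteq> set (take n w)" unfolding n_def by (rule LeastI[of _ "length w"]) (rule ex)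
    have nle: "n \<le> length w" unfolding n_def by (rule Least_le) (rule ex)
    have n0: "n \<noteq> 0" using n assms by (metis set_empty2 subset_empty take_0)
    have wne: "w \<noteq> []" using n assms by auto
    have min: "\<not> S \<subseteq> set (take (n - 1) w)"
      using n0 not_less_Least[of "n - 1" "\<lambda>n. S \<subseteq> set (take n w)"] unfolding n_def by force
    have bl: "butlast (take n w) = take (n - 1) w" using nle by (simp add: butlast_take)
    have ne: "take n w \<noteq> []" using n0 wne by simp
    have "set (take n w) = insert (last (take n w)) (set (take (n - 1) w))"
      using arg_cong[OF append_butlast_last_id[OF ne], of set] bl by auto
    then have arch: "is_arch S (take n w)"
      using n min ne bl by (auto simp: is_arch_iff insert_absorb)
    have "length (drop n w) < length w" using n0 wne by simp
    then obtain as r where "is_arch_factorization S (drop n w) as r" using 1 by blast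
    then have "is_arch_factorization S w (take n w # as) r"
      using arch unfolding is_arch_factorization_def
      by (metis append_assoc append_take_drop_id concat.simps(2) set_ConsD)
    then show ?thesis by blast
  qed
qed

lemma is_arch_prefix:
  assumes "is_arch S a" "is_arch S b" "set b \<subseteq> S" "b = a @ z"
  shows "z = []"
proof (rule ccontr)
  assume z: "z \<noteq> []"
  then have "butlast b = a @ butlast z" using assms(4) by (simp add: butlast_append)
  moreover have "last b \<in> S" using assms(2,3) by (auto simp: is_arch_iff)
  ultimately show False using assms(1,2) by (auto simp: is_arch_iff)
qed

lemma arch_factorization_unique:
  assumes "w \<in> lists S" "is_arch_factorization S w as r" "is_arch_factorization S w as' r'"
  shows "as = as' \<and> r = r'"
  using assms
proof (induction as arbitrary: w as')
  case Nil
  then show ?case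
    by (cases as') (auto simp: is_arch_factorization_def is_arch_def)
next
  case (Cons a as)
  show ?case
  proof (cases as')
    case Nil
    then show ?thesis using Cons.prems by (auto simp: is_arch_factorization_def is_arch_def)
  next
    case as': (Cons b bs)
    have e: "w = a @ concat as @ r" "w = b @ concat bs @ r'"
      and arch: "is_arch S a" "is_arch S b"
      using Cons.prems as' by (simp_all add: is_arch_factorization_def)
    have "set w \<subseteq> S" using Cons.prems(1) by auto
    then have sub: "set a \<subseteq> S" "set b \<subseteq> S"
      by (metis e(1) set_append sup.bounded_iff, metis e(2) set_append sup.bounded_iff)
    from e have "(\<exists>z. a = b @ z) \<or> (\<exists>z. b = a @ z)"
      by (metis append_eq_append_conv2)
    then have ab: "a = b"
    proof (elim disjE exE)
      fix z assume z: "a = b @ z"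
      then show ?thesis using is_arch_prefix[OF arch(2,1) sub(1) z] by simp
    next
      fix z assume z: "b = a @ z"
      then show ?thesis using is_arch_prefix[OF arch(1,2) sub(2) z] by simp
    qed
    have "is_arch_factorization S (concat as @ r) as r"
         "is_arch_factorization S (concat as @ r) bs r'"
         "concat as @ r \<in> lists S"
      using Cons.prems as' ab by (simp_all add: is_arch_factorization_def)
    then show ?thesis using Cons.IH ab as' by blast
  qed
qed

lemma arch_factorization_eq:
  assumes "w \<in> lists S" "is_arch_factorization S w as r"
  shows "arch_factorization S w = (as, r)"
  unfolding arch_factorization_def
proof (rule the_equality)
  show "case (as, r) of (as, r) \<Rightarrow> is_arch_factorization S w as r" using assms(2) by simp
  fix p assume "case p of (as, r) \<Rightarrow> is_arch_factorization S w as r"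
  then show "p = (as, r)"
    using arch_factorization_unique[OF assms(1) _ assms(2)] by (cases p) simp
qed

lemma arch_factorization_is:
  assumes "w \<in> lists S" "S \<noteq> {}"
  shows "is_arch_factorization S w (fst (arch_factorization S w)) (snd (arch_factorization S w))"
proof -
  obtain as r where "is_arch_factorization S w as r"
    using arch_factorization_exists[OF assms(2)] by blast
  then show ?thesis using arch_factorization_eq[OF assms(1)] by simp
qed

lemma subseq_arches:
  assumes "\<forall>a \<in> set as. is_arch S a" "u \<in> lists S" "length u = length as"
  shows "subseq u (concat as @ r)"
  using assms
proof (induction as arbitrary: u)
  case (Cons a as)
  then obtain x v where u: "u = x # v" by (cases u) auto
  then have "x \<in> set a" using Cons.prems by (auto simp: is_arch_def)
  then have "subseq [x] a" by (simp add: subseq_singleton_left)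
  moreover have "subseq v (concat as @ r)" using Cons u by auto
  ultimately show ?case using u list_emb_append_mono[of "(=)" "[x]" a v] by simp
qed simp

lemma subseq_Cons_notin:
  assumes "x \<notin> set b" "subseq (x # u) (b @ x # v)"
  shows "subseq u v"
  using assms by (induction b) (auto split: if_splits)

lemma not_subseq_last_arches:
  assumes "\<forall>a \<in> set as. is_arch S a" "c \<notin> set r"
  shows "\<not> subseq (map last as @ c # v) (concat as @ r)"
  using assms
proof (induction as)
  case Nil
  then show ?case using list_emb_set[of "(=)" "c # v" r c] by auto
next
  case (Cons a as)
  then have a: "a \<noteq> []" "last a \<notin> set (butlast a)" by (auto simp: is_arch_iff)
  have e: "concat (a # as) @ r = butlast a @ last a # (concat as @ r)"
    using append_butlast_last_id[OF a(1)] by (metis append.assoc append_Cons append_Nil concat.simps(2))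
  have IH: "\<not> subseq (map last as @ c # v) (concat as @ r)" using Cons by simp
  show ?case
  proof
    assume "subseq (map last (a # as) @ c # v) (concat (a # as) @ r)"
    then have "subseq (last a # (map last as @ c # v)) (butlast a @ last a # (concat as @ r))"
      unfolding e by simp
    from subseq_Cons_notin[OF a(2) this] show False using IH by blast
  qed
qed

lemma univ_index_eq_length:
  assumes "w \<in> lists S" "is_arch_factorization S w as r"
  shows "univ_index S w = length as"
  unfolding univ_index_def
proof (rule Greatest_equality)
  have w: "w = concat as @ r" and arch: "\<forall>a \<in> set as. is_arch S a"
    using assms(2) by (auto simp: is_arch_factorization_def)
  show "\<forall>u \<in> lists S. length u = length as \<longrightarrow> subseq u w"
    using subseq_arches arch w by blast
  fix l assume l: "\<forall>u \<in> lists S. length u = l \<longrightarrow> subseq u w"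
  show "l \<le> length as"
  proof (rule ccontr)
    assume less: "\<not> l \<le> length as"
    obtain c where c: "c \<in> S" "c \<notin> set r" using assms(2) by (auto simp: is_arch_factorization_def)
    let ?u = "map last as @ c # replicate (l - length as - 1) c"
    have "last a \<in> S" if "a \<in> set as" for a
      using that arch assms(1) w by (auto simp: is_arch_iff)
    then have "?u \<in> lists S" using c by auto
    moreover have "length ?u = l" using less by simp
    ultimately show False using l not_subseq_last_arches[OF arch c(2)] w by blast
  qed
qed

end

theory Submission
  imports Defs
begin

text \<open>Write \<open>w = P @ B @ Q\<close> with \<open>P\<close> the first \<open>i - 1\<close> arches, \<open>B = \<alpha>\<^sub>i\<^sub>-\<^sub>1 \<beta>\<^sub>i \<alpha>\<^sub>i\<close> and \<open>Q\<close> the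
  last \<open>m - i\<close> reverse arches, and likewise for \<open>w'\<close>.

  From \<open>w\<close> to the blocks: let \<open>s\<close> collect the last letters of the arches of \<open>P'\<close> and \<open>t\<close> the first
  letters of the reverse arches of \<open>Q'\<close>. By universality \<open>s\<close> and \<open>t\<close> embed into \<open>P\<close> and \<open>Q\<close>, whereas
  an embedding of \<open>s @ u @ t\<close> into \<open>w'\<close> is forced to place \<open>u\<close> inside \<open>B'\<close>.

  From the blocks to \<open>w\<close>: given \<open>u\<close> embedded into \<open>w\<close>, one moves it into \<open>w'\<close> arch by arch, keeping
  a splitting \<open>u = s @ z\<close> with \<open>s\<close> embedded into the first \<open>i\<close> arches of \<open>w'\<close> and \<open>z\<close>, of length at
  most \<open>k - i\<close>, embedded into \<open>\<alpha>\<^sub>i\<close> followed by the remaining reverse arches of \<open>w\<close>. As the reverse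
  arches after \<open>B\<close> absorb every word of length \<open>m - i\<close>, only a prefix of \<open>z\<close> of length at most
  \<open>k - m + 1\<close> has to be placed into \<open>B\<close>; it moves to \<open>B'\<close>, its part in the arch of \<open>w'\<close> joins \<open>s\<close>,
  and the remainder lies in \<open>\<alpha>'\<^sub>i\<close>, hence in \<open>\<alpha>\<^sub>i\<close>.\<close>

section \<open>Simon's congruence and reversal of scattered factors\<close>

lemma simon_cong_sym: "simon_cong k u v \<Longrightarrow> simon_cong k v u"
  by (simp add: simon_cong_def)

lemma simon_congD: "simon_cong k u v \<Longrightarrow> subseq x u \<Longrightarrow> length x \<le> k \<Longrightarrow> subseq x v"
  by (simp add: simon_cong_def)

lemma simon_congI:
  assumes "\<And>x. length x \<le> k \<Longrightarrow> subseq x u \<Longrightarrow> subseq x v"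
    and "\<And>x. length x \<le> k \<Longrightarrow> subseq x v \<Longrightarrow> subseq x u"
  shows "simon_cong k u v"
  using assms by (auto simp: simon_cong_def)

lemma subseq_rev_mono: "subseq u v \<Longrightarrow> subseq (rev u) (rev v)"
proof (induction rule: list_emb.induct)
  case (list_emb_Cons xs ys y)
  then show ?case by (simp add: subseq_rev_drop_many)
qed (auto intro: list_emb_append_mono)

lemma subseq_rev [simp]: "subseq (rev u) (rev v) \<longleftrightarrow> subseq u v"
  using subseq_rev_mono[of u v] subseq_rev_mono[of "rev u" "rev v"] by auto

section \<open>Embedding words into sequences of arches\<close>

lemma subseq_short_arches:
  assumes "\<forall>a \<in> set as. is_arch S a" "u \<in> lists S" "length u \<le> length as"
  shows "subseq u (concat as)"
proof -
  have "subseq u (concat (take (length u) as) @ concat (drop (length u) as))"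
    using assms by (intro subseq_arches[of _ S]) (auto dest: in_set_takeD)
  then show ?thesis by (metis append_take_drop_id concat_append)
qed

text \<open>The last letter of an arch occurs nowhere else in it, so matching that letter uses up
  the whole arch.\<close>

lemma subseq_strip_arches:
  assumes "\<forall>a \<in> set as. is_arch S a" "subseq (map last as @ v) (concat as @ r)"
  shows "subseq v r"
  using assms
proof (induction as)
  case (Cons a as)
  then have a: "a \<noteq> []" "last a \<notin> set (butlast a)" by (auto simp: is_arch_iff)
  then have "concat (a # as) @ r = butlast a @ last a # (concat as @ r)"
    using append_butlast_last_id[OF a(1)]
    by (metis append.assoc append_Cons append_Nil concat.simps(2))
  then have "subseq (last a # (map last as @ v)) (butlast a @ last a # (concat as @ r))"
    using Cons.prems(2) by (metis append_Cons list.simps(9))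
  from subseq_Cons_notin[OF a(2) this] have "subseq (map last as @ v) (concat as @ r)" .
  then show ?case using Cons by simp
qed simp

lemma subseq_short_rev_arches:
  assumes "\<forall>a \<in> set as. is_arch S (rev a)" "u \<in> lists S" "length u \<le> length as"
  shows "subseq u (concat as)"
proof -
  have "subseq (rev u) (concat (map rev (rev as)))"
    using assms by (intro subseq_short_arches[of _ S]) auto
  then show ?thesis by (simp add: rev_concat[symmetric] rev_map)
qed

text \<open>Mirror image of \<open>subseq_strip_arches\<close>: reversal turns first letters of
  reverse arches into last letters of arches.\<close>

lemma subseq_strip_rev_arches:
  assumes "\<forall>a \<in> set as. is_arch S (rev a)" "subseq (v @ map hd as) (r @ concat as)"
  shows "subseq v r"
proof -
  have ne: "a \<noteq> []" if "a \<in> set as" for a using assms(1) that by (auto simp: is_arch_iff)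
  have "map last (map rev (rev as)) = rev (map hd as)"
    using ne by (simp add: rev_map last_rev)
  moreover have "subseq (rev (v @ map hd as)) (rev (r @ concat as))"
    using assms(2) by (simp only: subseq_rev)
  moreover have "concat (map rev (rev as)) = rev (concat as)"
    by (simp add: rev_concat rev_map)
  ultimately have "subseq (map last (map rev (rev as)) @ rev v) (concat (map rev (rev as)) @ rev r)"
    by (simp only: rev_append)
  then have "subseq (rev v) (rev r)"
    by (rule subseq_strip_arches[rotated]) (use assms(1) in auto)
  then show ?thesis by simp
qed

text \<open>If an embedding puts more than \<open>p\<close> letters into \<open>B\<close>, the cut
  is made after \<open>p\<close> letters instead: at most \<open>q\<close> letters remain, and
  \<open>C\<close> absorbs them by the third hypothesis.\<close>

lemma subseq_split_short:
  assumes "subseq z (B @ C)" "length z \<le> p + q"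
    and "\<And>y. subseq y (B @ C) \<Longrightarrow> length y \<le> q \<Longrightarrow> subseq y C"
  obtains x y where "z = x @ y" "subseq x B" "subseq y C" "length x \<le> p"
proof -
  obtain x y where xy: "z = x @ y" "subseq x B" "subseq y C"
    using assms(1) by (auto simp: subseq_append_iff elim: subseq_appendE)
  show thesis
  proof (cases "length x \<le> p")
    case True
    then show ?thesis using xy that by blast
  next
    case False
    have "subseq (take p z) B"
      using False xy(1) subseq_order.trans[OF prefix_imp_subseq[OF take_is_prefix[of p x]] xy(2)]
      by simp
    moreover have rest: "subseq (drop p z) (B @ C)"
      using assms(1) by (meson subseq_order.trans suffix_imp_subseq suffix_drop)
    moreover from rest have "subseq (drop p z) C" using assms(2) by (intro assms(3)) simp_all
    ultimately show ?thesis
      by (intro that[of "take p z" "drop p z"]) auto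
  qed
qed

section \<open>Cutting a word into arches, a block and reverse arches\<close>

lemma univ_index_rev: "univ_index S (rev w) = univ_index S w"
proof -
  have "(\<forall>u \<in> lists S. length u = l \<longrightarrow> subseq u (rev w)) \<longleftrightarrow>
        (\<forall>u \<in> lists S. length u = l \<longrightarrow> subseq u w)" for l
    by (metis in_lists_conv_set length_rev rev_rev_ident set_rev subseq_rev)
  then show ?thesis by (simp add: univ_index_def)
qed

lemma is_arch_ar:
  assumes "w \<in> lists S" "S \<noteq> {}" "1 \<le> i" "i \<le> univ_index S w"
  shows "is_arch S (ar S w i)"
proof -
  have fac: "is_arch_factorization S w (fst (arch_factorization S w)) (snd (arch_factorization S w))"
    using arch_factorization_is[OF assms(1,2)] .
  then have "i - 1 < length (fst (arch_factorization S w))"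
    using univ_index_eq_length[OF assms(1) fac] assms(3,4) by simp
  then show ?thesis using fac by (auto simp: is_arch_factorization_def ar_def)
qed

locale alpha_beta_word =
  fixes S :: "'a set" and m :: nat and w :: "'a list" and \<alpha> \<beta> :: "nat \<Rightarrow> 'a list"
  assumes word: "w \<in> lists S"
    and factorization: "w = \<alpha> 0 @ concat (map (\<lambda>i. \<beta> i @ \<alpha> i) [1..<Suc m])"
    and arch: "1 \<le> i \<Longrightarrow> i \<le> m \<Longrightarrow> is_arch S (\<alpha> (i - 1) @ \<beta> i)"
    and rev_arch: "1 \<le> i \<Longrightarrow> i \<le> m \<Longrightarrow> is_arch S (rev (\<beta> i @ \<alpha> i))"
begin

definition arches :: "nat \<Rightarrow> 'a list list" where
  "arches i = map (\<lambda>j. \<alpha> (j - 1) @ \<beta> j) [1..<Suc i]"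

text \<open>The argument counts the reverse arches left out, so \<open>arches i\<close>,
  \<open>\<alpha> i\<close> and \<open>rarches i\<close> fit together.\<close>

definition rarches :: "nat \<Rightarrow> 'a list list" where
  "rarches i = map (\<lambda>j. \<beta> j @ \<alpha> j) [Suc i..<Suc m]"

definition block :: "nat \<Rightarrow> 'a list" where
  "block i = \<alpha> (i - 1) @ \<beta> i @ \<alpha> i"

lemma length_arches [simp]: "length (arches i) = i"
  by (simp add: arches_def)

lemma length_rarches [simp]: "length (rarches i) = m - i"
  by (simp add: rarches_def del: upt_Suc)

lemma is_arch_arches: "i \<le> m \<Longrightarrow> \<forall>a \<in> set (arches i). is_arch S a"
  using arch by (auto simp: arches_def simp del: upt_Suc)

lemma is_arch_rarches: "\<forall>a \<in> set (rarches i). is_arch S (rev a)"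
  using rev_arch by (auto simp: rarches_def simp del: upt_Suc rev_append)

lemma arches_Suc: "arches (Suc i) = arches i @ [\<alpha> i @ \<beta> (Suc i)]"
  by (simp add: arches_def)

lemma rarches_Suc: "i < m \<Longrightarrow> rarches i = (\<beta> (Suc i) @ \<alpha> (Suc i)) # rarches (Suc i)"
  unfolding rarches_def by (subst upt_conv_Cons) auto

text \<open>Passing from \<open>i\<close> to \<open>Suc i\<close> only regroups:
  \<open>\<beta> (Suc i)\<close> leaves its reverse arch and completes the arch begun by
  \<open>\<alpha> i\<close>.\<close>

lemma split_arches_rarches: "i \<le> m \<Longrightarrow> w = concat (arches i) @ \<alpha> i @ concat (rarches i)"
proof (induction i)
  case 0
  then show ?case using factorization by (simp add: arches_def rarches_def del: upt_Suc)
next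
  case (Suc i)
  then show ?case by (simp add: arches_Suc rarches_Suc)
qed

lemma split_block: "i < m \<Longrightarrow> w = concat (arches i) @ block (Suc i) @ concat (rarches (Suc i))"
  using split_arches_rarches[of i] by (simp add: rarches_Suc block_def)

lemma set_arches: "i \<le> m \<Longrightarrow> a \<in> set (arches i) \<Longrightarrow> set a \<subseteq> S"
  using arg_cong[OF split_arches_rarches[of i], of set] word by auto

lemma set_rarches: "i \<le> m \<Longrightarrow> a \<in> set (rarches i) \<Longrightarrow> set a \<subseteq> S"
  using arg_cong[OF split_arches_rarches[of i], of set] word by auto

lemma map_last_arches_lists: "i \<le> m \<Longrightarrow> map last (arches i) \<in> lists S"
  using set_arches[of i] is_arch_arches[of i] by (fastforce simp: is_arch_iff)

lemma map_hd_rarches_lists: "i \<le> m \<Longrightarrow> map hd (rarches i) \<in> lists S"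
  using set_rarches[of i] is_arch_rarches[of i] by (fastforce simp: is_arch_iff)

lemma subseq_strip_alpha:
  assumes "i < m" "subseq (last (\<alpha> i @ \<beta> (Suc i)) # x) (block (Suc i))"
  shows "subseq x (\<alpha> (Suc i))"
proof -
  have "is_arch S (\<alpha> i @ \<beta> (Suc i))" using arch[of "Suc i"] assms(1) by simp
  then show ?thesis
    using subseq_strip_arches[of "[\<alpha> i @ \<beta> (Suc i)]" S x "\<alpha> (Suc i)"] assms(2)
    by (simp add: block_def)
qed

end

lemma alpha_beta_word_of_factorization:
  assumes "w \<in> lists S" "S \<noteq> {}" "is_alpha_beta_factorization S w \<alpha> \<beta>"
  shows "alpha_beta_word S (univ_index S w) w \<alpha> \<beta>"
proof
  fix i assume i: "1 \<le> i" "i \<le> univ_index S w"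
  then have eq: "ar S w i = \<alpha> (i - 1) @ \<beta> i" "ra S w i = \<beta> i @ \<alpha> i"
    using assms(3) by (auto simp: is_alpha_beta_factorization_def)
  show "is_arch S (\<alpha> (i - 1) @ \<beta> i)" using is_arch_ar[OF assms(1,2) i] eq by simp
  \<comment> \<open>\<open>ra\<close> indexes arches of \<open>rev w\<close> by the universality
    index of \<open>w\<close>; the two words have the same index.\<close>
  have "is_arch S (ar S (rev w) (univ_index S w - i + 1))"
    using assms(1,2) i by (intro is_arch_ar) (auto simp: univ_index_rev)
  then show "is_arch S (rev (\<beta> i @ \<alpha> i))"
    unfolding eq(2)[symmetric] ra_def by simp
next
  show "w = \<alpha> 0 @ concat (map (\<lambda>i. \<beta> i @ \<alpha> i) [1..<Suc (univ_index S w)])"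
    using assms(3) unfolding is_alpha_beta_factorization_def by (rule conjunct1)
qed (fact assms(1))

section \<open>Transfer of scattered factors between two words\<close>

locale alpha_beta_pair =
  A: alpha_beta_word S m w \<alpha> \<beta> + B: alpha_beta_word S m w' \<alpha>' \<beta>'
  for S :: "'a set" and m w \<alpha> \<beta> w' \<alpha>' \<beta>'
begin

lemma subseq_block_transfer:
  assumes "simon_cong k w w'" "m < k" "i < m"
    and u: "subseq u (A.block (Suc i))" "length u \<le> k - m + 1"
  shows "subseq u (B.block (Suc i))"
proof -
  let ?s = "map last (B.arches i)" and ?t = "map hd (B.rarches (Suc i))"
  have "subseq ?s (concat (A.arches i))"
    using assms(3) A.is_arch_arches[of i] B.map_last_arches_lists[of i]
    by (intro subseq_short_arches[of _ S]) auto
  moreover have "subseq ?t (concat (A.rarches (Suc i)))"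
    using assms(3) A.is_arch_rarches B.map_hd_rarches_lists[of "Suc i"]
    by (intro subseq_short_rev_arches[of _ S]) auto
  ultimately have "subseq (?s @ u @ ?t) w"
    unfolding A.split_block[OF assms(3)] using u(1) by (intro list_emb_append_mono)
  \<comment> \<open>The length is at most \<open>i + (k - m + 1) + (m - Suc i) = k\<close>.\<close>
  then have "subseq (?s @ u @ ?t) w'"
    using assms u(2) by (elim simon_congD[OF assms(1)]) simp
  then have "subseq (?s @ u @ ?t)
      (concat (B.arches i) @ B.block (Suc i) @ concat (B.rarches (Suc i)))"
    using B.split_block[OF assms(3)] by simp
  then have "subseq (u @ ?t) (B.block (Suc i) @ concat (B.rarches (Suc i)))"
    by (rule subseq_strip_arches[OF B.is_arch_arches, rotated]) (use assms(3) in simp)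
  then show ?thesis using B.is_arch_rarches by (rule subseq_strip_rev_arches[rotated])
qed

text \<open>One extra letter, the last letter of the arch of \<open>w\<close>, pins \<open>x\<close>
  down: the arch of \<open>w'\<close> contains it, being universal, and back in \<open>w\<close> it
  uses up the arch. This costs one level of the congruence.\<close>

lemma subseq_alpha_transfer:
  assumes "simon_cong (Suc p) (A.block (Suc i)) (B.block (Suc i))" "i < m"
    and "subseq x (\<alpha>' (Suc i))" "length x \<le> p"
  shows "subseq x (\<alpha> (Suc i))"
proof -
  let ?c = "last (\<alpha> i @ \<beta> (Suc i))"
  have "?c \<in> S"
    using A.map_last_arches_lists[of "Suc i"] assms(2) by (simp add: A.arches_Suc)
  moreover have "is_arch S (\<alpha>' i @ \<beta>' (Suc i))"
    using B.arch[of "Suc i"] assms(2) by simp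
  ultimately have "subseq [?c] (\<alpha>' i @ \<beta>' (Suc i))"
    unfolding is_arch_iff subseq_singleton_left by blast
  then have "subseq ([?c] @ x) ((\<alpha>' i @ \<beta>' (Suc i)) @ \<alpha>' (Suc i))"
    using assms(3) by (rule list_emb_append_mono)
  then have "subseq (?c # x) (A.block (Suc i))"
    using assms(4) by (intro simon_congD[OF simon_cong_sym[OF assms(1)]]) (auto simp: B.block_def)
  then show ?thesis by (rule A.subseq_strip_alpha[OF assms(2)])
qed

text \<open>A nonempty \<open>z\<close> always gives up at least one letter to the arch of
  \<open>w'\<close>, which is why the length bound drops by one.\<close>

lemma subseq_arch_step:
  assumes "simon_cong (k - m + 1) (A.block (Suc i)) (B.block (Suc i))" "i < m" "m < k"
    and z: "z \<in> lists S" "subseq z (\<alpha> i @ concat (A.rarches i))" "length z \<le> k - i"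
  obtains s z' where "z = s @ z'" "subseq s (\<alpha>' i @ \<beta>' (Suc i))"
    "subseq z' (\<alpha> (Suc i) @ concat (A.rarches (Suc i)))" "length z' \<le> k - Suc i"
proof (cases z)
  case Nil
  then show ?thesis using that[of "[]" "[]"] by simp
next
  case (Cons c zs)
  have S: "S \<subseteq> set (\<alpha>' i @ \<beta>' (Suc i))"
    using B.arch[of "Suc i"] assms(2) by (simp add: is_arch_def)
  have blockC: "subseq z (A.block (Suc i) @ concat (A.rarches (Suc i)))"
    using z(2) assms(2) by (simp add: A.rarches_Suc A.block_def)
  have absorb: "subseq y (concat (A.rarches (Suc i)))"
    if "subseq y (A.block (Suc i) @ concat (A.rarches (Suc i)))" "length y \<le> m - Suc i" for y
  proof -
    have "subseq y w"
      unfolding A.split_block[OF assms(2)] using that(1) by (rule subseq_drop_many)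
    then have "y \<in> lists S" using A.word by (auto dest: list_emb_set)
    then show ?thesis
      using that(2) A.is_arch_rarches by (intro subseq_short_rev_arches[of _ S]) auto
  qed
  have "length z \<le> (k - m + 1) + (m - Suc i)" using z(3) assms(2,3) by simp
  from subseq_split_short[OF blockC this absorb]
  obtain x y where xy: "z = x @ y" "subseq x (A.block (Suc i))"
    "subseq y (concat (A.rarches (Suc i)))" "length x \<le> k - m + 1" .
  show ?thesis
  proof (cases x)
    \<comment> \<open>All of \<open>z\<close> lies behind the block, so its first letter can be
      spent on the arch of \<open>w'\<close>.\<close>
    case Nil
    have "subseq zs (\<alpha> (Suc i) @ concat (A.rarches (Suc i)))"
      using xy(1,3) Nil Cons by (metis append_Nil subseq_Cons' subseq_drop_many)
    moreover have "subseq [c] (\<alpha>' i @ \<beta>' (Suc i))"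
      using S z(1) Cons unfolding subseq_singleton_left by auto
    ultimately show ?thesis using that[of "[c]" zs] Cons z(3) by simp
  next
    case (Cons d xs)
    have "subseq x ((\<alpha>' i @ \<beta>' (Suc i)) @ \<alpha>' (Suc i))"
      using simon_congD[OF assms(1) xy(2,4)] by (simp add: B.block_def)
    \<comment> \<open>If the embedding skips the arch, the first letter of \<open>x\<close> is moved
      into it, since the arch contains every letter of \<open>S\<close>.\<close>
    then obtain x1 x2 where x: "x = x1 @ x2" "subseq x1 (\<alpha>' i @ \<beta>' (Suc i))"
      "subseq x2 (\<alpha>' (Suc i))" "x1 \<noteq> []"
    proof (rule subseq_appendE)
      fix x1 x2 assume h: "subseq x1 (\<alpha>' i @ \<beta>' (Suc i))" "subseq x2 (\<alpha>' (Suc i))" "x = x1 @ x2"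
      show thesis
      proof (cases "x1 = []")
        case False
        then show ?thesis using that h by blast
      next
        case True
        have "subseq [d] (\<alpha>' i @ \<beta>' (Suc i))"
          using S z(1) xy(1) Cons unfolding subseq_singleton_left by auto
        moreover have "subseq xs (\<alpha>' (Suc i))"
          using h True Cons by (metis append_Nil subseq_Cons')
        ultimately show ?thesis using that[of "[d]" xs] Cons by simp
      qed
    qed
    have len: "length x1 > 0" "length x = length x1 + length x2" "length z = length x + length y"
      using x xy(1) by simp_all
    \<comment> \<open>As \<open>x1\<close> is nonempty, \<open>x2\<close> is one letter shorter than
      the congruence level, as \<open>subseq_alpha_transfer\<close> requires.\<close>
    have "length x2 \<le> k - m" using len xy(4) by linarith
    then have "subseq x2 (\<alpha> (Suc i))"
      using assms(1) by (intro subseq_alpha_transfer[OF _ assms(2) x(3)]) simp_all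
    then have "subseq (x2 @ y) (\<alpha> (Suc i) @ concat (A.rarches (Suc i)))"
      using xy(3) by (rule list_emb_append_mono)
    moreover have "length (x2 @ y) \<le> k - Suc i"
      using len z(3) by (simp, linarith)
    ultimately show ?thesis using that[of x1 "x2 @ y"] x(1,2) xy(1) by simp
  qed
qed

lemma subseq_transfer_invariant:
  assumes "\<And>i. i < m \<Longrightarrow> simon_cong (k - m + 1) (A.block (Suc i)) (B.block (Suc i))" "m < k"
    and u: "subseq u w" "length u \<le> k" and "i \<le> m"
  shows "\<exists>s z. u = s @ z \<and> subseq s (concat (B.arches i)) \<and>
    subseq z (\<alpha> i @ concat (A.rarches i)) \<and> length z \<le> k - i"
  using \<open>i \<le> m\<close>
proof (induction i)
  case 0
  then show ?case using u A.split_arches_rarches[of 0] by (auto simp: A.arches_def)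
next
  case (Suc i)
  then obtain s z where sz: "u = s @ z" "subseq s (concat (B.arches i))"
    "subseq z (\<alpha> i @ concat (A.rarches i))" "length z \<le> k - i" by auto
  have im: "i < m" using Suc.prems by simp
  have "u \<in> lists S" using u(1) A.word by (auto dest: list_emb_set)
  then have "z \<in> lists S" using sz(1) by simp
  from subseq_arch_step[OF assms(1)[OF im] im assms(2) this sz(3,4)]
  obtain s' z' where "z = s' @ z'" "subseq s' (\<alpha>' i @ \<beta>' (Suc i))"
    "subseq z' (\<alpha> (Suc i) @ concat (A.rarches (Suc i)))" "length z' \<le> k - Suc i" .
  moreover from this(2) have "subseq (s @ s') (concat (B.arches (Suc i)))"
    using list_emb_append_mono[OF sz(2)] by (simp add: B.arches_Suc)
  ultimately show ?case using sz(1) by (metis append.assoc)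
qed

lemma subseq_word_transfer:
  assumes "\<And>i. i < m \<Longrightarrow> simon_cong (k - m + 1) (A.block (Suc i)) (B.block (Suc i))" "m < k" "1 \<le> m"
    and "subseq u w" "length u \<le> k"
  shows "subseq u w'"
proof -
  \<comment> \<open>The invariant is used one arch before the end: there \<open>\<alpha> i\<close>
    and the only remaining reverse arch form the last block, and \<open>k - i = k - m + 1\<close>.
    This last block exists because \<open>1 \<le> m\<close>.\<close>
  obtain i where m: "m = Suc i" using assms(3) by (cases m) auto
  then have im: "i < m" by simp
  obtain s z where sz: "u = s @ z" "subseq s (concat (B.arches i))"
    "subseq z (\<alpha> i @ concat (A.rarches i))" "length z \<le> k - i"
    using subseq_transfer_invariant[OF assms(1,2,4,5), of i] im by auto
  have nil: "A.rarches (Suc i) = []" "B.rarches (Suc i) = []"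
    using A.length_rarches[of "Suc i"] B.length_rarches[of "Suc i"] m
    by (simp_all only: diff_self_eq_0 length_0_conv)
  have "subseq z (A.block (Suc i))"
    using sz(3) by (simp add: A.rarches_Suc[OF im] nil A.block_def)
  then have "subseq z (B.block (Suc i))"
    using simon_congD[OF assms(1)[OF im]] sz(4) assms(2) m by simp
  then show ?thesis
    using list_emb_append_mono[OF sz(2)] B.split_block[OF im] sz(1) nil by simp
qed

end

theorem theorem1:
  fixes S :: "'a set"
    and k m :: nat
    and w w' :: "'a list"
    and \<alpha> \<beta> \<alpha>' \<beta>' :: "nat \<Rightarrow> 'a list"
  assumes "finite S"
    and "w \<in> lists S" and "w' \<in> lists S"
    and "m = univ_index S w" and "m = univ_index S w'"
    and "1 \<le> m" and "m < k"
    and "is_alpha_beta_factorization S w \<alpha> \<beta>"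
    and "is_alpha_beta_factorization S w' \<alpha>' \<beta>'"
  shows "simon_cong k w w' \<longleftrightarrow>
    (\<forall>i \<in> {1..m}. simon_cong (k - m + 1)
        (\<alpha> (i - 1) @ \<beta> i @ \<alpha> i) (\<alpha>' (i - 1) @ \<beta>' i @ \<alpha>' i))"
proof (cases "S = {}")
  case True
  \<comment> \<open>Here \<open>univ_index\<close> is a junk value, but both words and all their factors are empty.\<close>
  have empty: "w = []" "w' = []" using assms(2,3) True by auto
  have fac: "\<alpha> 0 @ concat (map (\<lambda>i. \<beta> i @ \<alpha> i) [1..<Suc m]) = []"
    "\<alpha>' 0 @ concat (map (\<lambda>i. \<beta>' i @ \<alpha>' i) [1..<Suc m]) = []"
    using assms(4,5,8,9) empty unfolding is_alpha_beta_factorization_def by metis+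
  have "\<alpha> (i - 1) @ \<beta> i @ \<alpha> i = [] \<and> \<alpha>' (i - 1) @ \<beta>' i @ \<alpha>' i = []" if i: "i \<in> {1..m}" for i
  proof -
    have nil: "\<alpha> 0 = []" "\<alpha>' 0 = []" "\<forall>j \<in> {1..m}. \<beta> j @ \<alpha> j = [] \<and> \<beta>' j @ \<alpha>' j = []"
      using fac by (auto simp del: upt_Suc)
    have "i - 1 = 0 \<or> i - 1 \<in> {1..m}" using i by auto
    then show ?thesis using nil i by auto
  qed
  then show ?thesis using empty by (simp add: simon_cong_def)
next
  case False
  interpret A: alpha_beta_word S m w \<alpha> \<beta>
    using alpha_beta_word_of_factorization[OF assms(2) False assms(8)] assms(4) by simp
  interpret B: alpha_beta_word S m w' \<alpha>' \<beta>'
    using alpha_beta_word_of_factorization[OF assms(3) False assms(9)] assms(5) by simp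
  \<comment> \<open>Both orders are needed: \<open>subseq_block_transfer\<close> and
    \<open>subseq_word_transfer\<close> only go from the first word to the second.\<close>
  interpret AB: alpha_beta_pair S m w \<alpha> \<beta> w' \<alpha>' \<beta>' ..
  interpret BA: alpha_beta_pair S m w' \<alpha>' \<beta>' w \<alpha> \<beta> ..
  have "simon_cong k w w' \<longleftrightarrow>
    (\<forall>i<m. simon_cong (k - m + 1) (A.block (Suc i)) (B.block (Suc i)))" (is "_ \<longleftrightarrow> ?R")
  proof
    assume cong: "simon_cong k w w'"
    show ?R
      using AB.subseq_block_transfer[OF cong assms(7)]
        BA.subseq_block_transfer[OF simon_cong_sym[OF cong] assms(7)]
      by (blast intro: simon_congI)
  next
    assume ?R
    then have "simon_cong (k - m + 1) (A.block (Suc i)) (B.block (Suc i))"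
      "simon_cong (k - m + 1) (B.block (Suc i)) (A.block (Suc i))" if "i < m" for i
      using that simon_cong_sym by blast+
    then show "simon_cong k w w'"
      using AB.subseq_word_transfer[OF _ assms(7,6)] BA.subseq_word_transfer[OF _ assms(7,6)]
      by (intro simon_congI) blast+
  qed
  moreover have "?R \<longleftrightarrow> (\<forall>i \<in> {1..m}. simon_cong (k - m + 1) (A.block i) (B.block i))"
    by (metis One_nat_def Suc_le_eq Suc_pred atLeastAtMost_iff le_add1 plus_1_eq_Suc)
  ultimately show ?thesis by (simp add: A.block_def B.block_def)
qed

end
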